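(* Let $\mu,\kappa,\theta$ be infinite cardinals such that $\mu^+<\kappa\le\theta$ and $\mathrm{cf}([\theta]^{\mu},\subseteq)\le\theta$. Let $\mathcal{J}=[\kappa]^{<\mu}$ and let $\gamma<\theta^+$ be an ordinal. Then $\mathrm{Depth}({}^{\kappa}\gamma,<_{\mathcal{J}})\le\theta$; that is, there is no sequence $\langle f_\alpha:\alpha<\theta^+\rangle$ of functions $f_\alpha\in{}^{\kappa}\gamma$ that is $<_{\mathcal{J}}$-increasing (i.e. such that $f_\alpha<_{\mathcal{J}}f_\beta$ for all $\alpha<\beta<\theta^+$).
   Context: For a set $X$ and a cardinal $\theta$, $[X]^{\theta}$ denotes the family of subsets of $X$ of cardinality $\theta$, and $[X]^{<\theta}$ the family of subsets of $X$ of cardinality less than $\theta$. ${}^{\kappa}\gamma$ is the set of all functions from $\kappa$ to $\gamma$. For an ideal $\mathcal{J}$ on $\kappa$ and functions $f,g$ from $\kappa$ to the ordinals, $f<_{\mathcal{J}}g$ means $\{i<\kappa: f(i)\ge g(i)\}\in\mathcal{J}$. For a partial order $(P,\sqsubset)$: $\mathrm{Depth}(P,\sqsubset)=\sup\{|\mathcal{F}|:\mathcal{F}\subseteq P \text{ is well-ordered by } \sqsubset\}$, and $\mathrm{cf}(P,\sqsubset)=\min\{|\mathcal{F}|:\mathcal{F}\subseteq P \text{ is cofinal}\}$, where $\mathcal{F}$ is cofinal if for every $p\in P$ there is $q\in\mathcal{F}$ with $p\sqsubseteq q$. In particular, $\mathrm{cf}([\theta]^{\mu},\subseteq)$ is the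 least cardinality of a family $\mathcal{F}\subseteq[\theta]^{\mu}$ such that every member of $[\theta]^{\mu}$ is contained in some member of $\mathcal{F}$. *)

theory Defs
  imports Main
begin

unbundle cardinal_syntax

text \<open>
  Ordinals are well-orders (\<^const>\<open>Well_order\<close>) and infinite cardinals are relations
  satisfying \<^abbrev>\<open>Cinfinite\<close>, each on an arbitrary type; their elements are the members
  of their fields, and they are compared by \<open>\<le>o\<close>, \<open><o\<close> and \<open>=o\<close>.
\<close>

definition subsets_of_card :: "'a set \<Rightarrow> 'b rel \<Rightarrow> 'a set set" where
  "subsets_of_card X r = {A. A \<subseteq> X \<and> |A| =o r}"

definition subsets_less_card :: "'a set \<Rightarrow> 'b rel \<Rightarrow> 'a set set" where
  "subsets_less_card X r = {A. A \<subseteq> X \<and> |A| <o r}"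

text \<open>
  \<^term>\<open>\<gamma>\<close> is a reflexive well-order, so \<open>(g i, f i) \<in> \<gamma>\<close> expresses \<open>f i \<ge> g i\<close>.
\<close>

definition less_mod :: "'a set \<Rightarrow> 'b rel \<Rightarrow> 'a set set \<Rightarrow> ('a \<Rightarrow> 'b) \<Rightarrow> ('a \<Rightarrow> 'b) \<Rightarrow> bool" where
  "less_mod K \<gamma> J f g \<longleftrightarrow> {i \<in> K. (g i, f i) \<in> \<gamma>} \<in> J"

text \<open>
  The order argument \<^term>\<open>lt\<close> below may be strict or reflexive: only its reflexive closure
  is used.
\<close>

definition cofinal_in :: "'p set \<Rightarrow> ('p \<Rightarrow> 'p \<Rightarrow> bool) \<Rightarrow> 'p set \<Rightarrow> bool" where
  "cofinal_in P lt F \<longleftrightarrow> F \<subseteq> P \<and> (\<forall>p\<in>P. \<exists>q\<in>F. lt\<^sup>=\<^sup>= p q)"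

definition well_ordered_subset :: "'p set \<Rightarrow> ('p \<Rightarrow> 'p \<Rightarrow> bool) \<Rightarrow> 'p set \<Rightarrow> bool" where
  "well_ordered_subset P lt F \<longleftrightarrow>
     F \<subseteq> P \<and> well_order_on F {(x, y). x \<in> F \<and> y \<in> F \<and> lt\<^sup>=\<^sup>= x y}"

definition cf :: "'p set \<Rightarrow> ('p \<Rightarrow> 'p \<Rightarrow> bool) \<Rightarrow> 'p rel" where
  "cf P lt = |SOME F. cofinal_in P lt F \<and> (\<forall>G. cofinal_in P lt G \<longrightarrow> |F| \<le>o |G| )|"

text \<open>
  The supremum defining the depth is at most \<open>|P|\<close>, hence it is the cardinality of some
  set of elements of the type of \<^term>\<open>P\<close>; that set represents the least upper bound and
  need not itself be well-ordered.
\<close>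

definition depth_bound :: "'p set \<Rightarrow> ('p \<Rightarrow> 'p \<Rightarrow> bool) \<Rightarrow> 'p set \<Rightarrow> bool" where
  "depth_bound P lt A \<longleftrightarrow> (\<forall>F. well_ordered_subset P lt F \<longrightarrow> |F| \<le>o |A| )"

definition Depth :: "'p set \<Rightarrow> ('p \<Rightarrow> 'p \<Rightarrow> bool) \<Rightarrow> 'p rel" where
  "Depth P lt = |SOME A. depth_bound P lt A \<and> (\<forall>B. depth_bound P lt B \<longrightarrow> |A| \<le>o |B| )|"

lemma ex_least_card:
  assumes "Q (A0 :: 'a set)"
  shows "\<exists>A. Q A \<and> (\<forall>B. Q B \<longrightarrow> |A| \<le>o |B| )"
proof -
  have wf: "wf (inv_image (ordLess :: ('a rel \<times> 'a rel) set) (\<lambda>A. |A| ))"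
    using wf_ordLess by (rule wf_inv_image)
  obtain A where "A \<in> Collect Q"
    and *: "\<And>B. (B, A) \<in> inv_image ordLess (\<lambda>A. |A| ) \<Longrightarrow> B \<notin> Collect Q"
    using wfE_min[OF wf, of A0 "Collect Q"] assms by blast
  then have "Q A" by simp
  moreover have "|A| \<le>o |B|" if "Q B" for B
  proof -
    have "\<not> |B| <o |A|" using *[of B] that by auto
    then show ?thesis using not_ordLeq_iff_ordLess[OF card_of_Well_order card_of_Well_order, of A B] by blast
  qed
  ultimately show ?thesis by blast
qed

lemma cf_attained:
  "\<exists>F. cofinal_in P lt F \<and> (\<forall>G. cofinal_in P lt G \<longrightarrow> |F| \<le>o |G| ) \<and> cf P lt = |F|"
proof -
  have "cofinal_in P lt P" by (auto simp: cofinal_in_def)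
  from someI_ex[OF ex_least_card[of "cofinal_in P lt", OF this]]
  show ?thesis unfolding cf_def by blast
qed

lemma Depth_least_aux:
  "\<exists>A. depth_bound P lt A \<and> (\<forall>B. depth_bound P lt B \<longrightarrow> |A| \<le>o |B| ) \<and> Depth P lt = |A|"
proof -
  have "depth_bound P lt P"
    by (auto simp: depth_bound_def well_ordered_subset_def card_of_mono1)
  from someI_ex[OF ex_least_card[of "depth_bound P lt", OF this]]
  show ?thesis unfolding Depth_def by blast
qed

lemma Depth_upper:
  "well_ordered_subset P lt F \<Longrightarrow> |F| \<le>o Depth P lt"
  using Depth_least_aux[of P lt] by (auto simp: depth_bound_def)

lemma Depth_least:
  fixes P :: "'p set" and r :: "'c rel"
  assumes "Card_order r" and ub: "\<And>F. well_ordered_subset P lt F \<Longrightarrow> |F| \<le>o r"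
  shows "Depth P lt \<le>o r"
proof (rule ccontr)
  obtain A where A: "\<And>B. depth_bound P lt B \<Longrightarrow> |A| \<le>o |B|" "Depth P lt = |A|"
    using Depth_least_aux[of P lt] by blast
  assume "\<not> Depth P lt \<le>o r"
  then have less: "r <o |A|"
    using A(2) not_ordLeq_iff_ordLess[OF card_order_on_well_order_on[OF assms(1)] card_of_Well_order, of A]
    by simp
  then have "|Field r| \<le>o |A|"
    by (rule ordIso_ordLeq_trans[OF card_of_Field_ordIso[OF assms(1)] ordLess_imp_ordLeq])
  then obtain h :: "'c \<Rightarrow> 'p" where h: "inj_on h (Field r)"
    unfolding card_of_ordLeq[symmetric] by blast
  have iso: "|h ` Field r| =o r"
    by (rule ordIso_transitive[OF ordIso_symmetric[OF card_of_ordIsoI[OF inj_on_imp_bij_betw[OF h]]]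
          card_of_Field_ordIso[OF assms(1)]])
  then have "depth_bound P lt (h ` Field r)"
    unfolding depth_bound_def using ordLeq_ordIso_trans[OF ub ordIso_symmetric[OF iso]] by simp
  then have "|A| \<le>o r" using ordLeq_ordIso_trans[OF A(1) iso] by simp
  then show False using not_ordLess_ordLeq[OF less] by simp
qed

end

theory Submission
  imports Defs
begin

text \<open>
  Split \<open>\<kappa>\<close> into \<open>\<kappa>\<close> many disjoint sets \<open>A\<^sub>\<xi>\<close> of size \<open>\<mu>\<close>. As \<open>\<theta>\<close> many sets of size \<open>\<mu>\<close>
  cover all small subsets of \<open>\<gamma>\<close>, there is for every \<open>\<xi>\<close> one set \<open>B\<^sub>\<xi>\<close> of size at most \<open>\<mu>\<close>
  such that \<open>f\<^sub>\<beta>[A\<^sub>\<xi>] \<subseteq> B\<^sub>\<xi>\<close> for unboundedly many \<open>\<beta> < \<theta>\<^sup>+\<close>. Since \<open>\<kappa> < \<theta>\<^sup>+\<close>, one can choose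
  pairs \<open>\<alpha>\<^sub>j < \<alpha>'\<^sub>j\<close> for \<open>j < \<mu>\<^sup>+\<close>, with \<open>\<alpha>'\<^sub>j < \<alpha>\<^sub>k\<close> for \<open>j < k\<close>, such that for every \<open>\<xi>\<close> some
  such \<open>\<beta>\<close> lies between \<open>\<alpha>\<^sub>j\<close> and \<open>\<alpha>'\<^sub>j\<close>. Altogether at most \<open>\<mu>\<^sup>+ < \<kappa>\<close> many coordinates violate
  \<open>f(\<alpha>'\<^sub>j) < f(\<alpha>\<^sub>k)\<close> for some \<open>j < k\<close>, so some \<open>A\<^sub>\<xi>\<close> contains none of them. Each \<open>j\<close> then
  yields a coordinate \<open>i\<^sub>j \<in> A\<^sub>\<xi>\<close> at which the value of \<open>f\<^sub>\<beta>\<close> is strictly between those of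
  \<open>f(\<alpha>\<^sub>j)\<close> and \<open>f(\<alpha>'\<^sub>j)\<close>, and mapping \<open>j\<close> to \<open>i\<^sub>j\<close> and this value is an injection of
  \<open>\<mu>\<^sup>+\<close> into \<open>A\<^sub>\<xi> \<times> B\<^sub>\<xi>\<close>, which has size \<open>\<mu>\<close>.
\<close>

lemma Linear_order_le_less_trans:
  assumes "Linear_order r" "(x, y) \<in> r" "(y, z) \<in> r - Id"
  shows "(x, z) \<in> r - Id"
proof -
  have "trans r" "antisym r" using assms(1) by (auto simp: order_on_defs)
  then have "(x, z) \<in> r" "x \<noteq> z"
    using assms(2,3) by (blast dest: transD, blast dest: antisymD)
  then show ?thesis by simp
qed

text \<open>The successor of an infinite cardinal is regular, so a set of at most \<open>r\<close>
  many elements cannot be cofinal in it.\<close>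

lemma cardSuc_strict_bound:
  assumes r: "Cinfinite r" and X: "X \<subseteq> Field (cardSuc r)" "|X| \<le>o r"
  shows "\<exists>b\<in>Field (cardSuc r). \<forall>x\<in>X. (x, b) \<in> cardSuc r - Id"
proof -
  let ?L = "cardSuc r"
  have card: "Card_order r" and inf: "\<not> finite (Field r)"
    using r by (auto simp: cinfinite_def)
  have L: "Card_order ?L" "\<not> finite (Field ?L)"
    using cardSuc_Card_order[OF card] cardSuc_finite[OF card] inf by auto
  have lin: "Linear_order ?L"
    using L(1) by (simp add: card_order_on_def well_order_on_def)
  have "regularCard ?L" using infinite_cardSuc_regularCard[OF inf card] .
  moreover have "\<not> |X| =o ?L"
    using ordLeq_ordLess_trans[OF X(2) cardSuc_greater[OF card]] not_ordLess_ordIso by blast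
  ultimately have "\<not> cofinal X ?L" using X(1) unfolding regularCard_def by blast
  then obtain a where a: "a \<in> Field ?L" "\<And>b. b \<in> X \<Longrightarrow> a = b \<or> (a, b) \<notin> ?L"
    unfolding cofinal_def by blast
  have le: "(x, a) \<in> ?L" if "x \<in> X" for x
    using a(2)[OF that] a(1) lin subsetD[OF X(1) that]
    by (cases "x = a") (auto simp: order_on_defs refl_on_def total_on_def)
  \<comment> \<open>The bound \<open>a\<close> may itself lie in \<open>X\<close>. An infinite
    cardinal has no last element, so a step past \<open>a\<close> makes the bound strict.\<close>
  obtain b where b: "b \<in> Field ?L" "a \<noteq> b" "(a, b) \<in> ?L"
    using infinite_Card_order_limit[OF L a(1)] by blast
  have "(x, b) \<in> ?L - Id" if "x \<in> X" for x
    using Linear_order_le_less_trans[OF lin le[OF that]] b(2,3) by simp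
  then show ?thesis using b(1) by blast
qed

text \<open>If every \<open>B\<close> failed beyond some point \<open>c B\<close>, these at most
  \<open>r\<close> many points would have a common strict upper bound, and at that bound no
  \<open>B\<close> would work.\<close>

lemma cardSuc_pigeonhole:
  assumes r: "Cinfinite r" and S: "|S| \<le>o r"
    and ex: "\<And>a. a \<in> Field (cardSuc r) \<Longrightarrow> \<exists>B\<in>S. P B a"
  shows "\<exists>B\<in>S. \<forall>a\<in>Field (cardSuc r). \<exists>b. (a, b) \<in> cardSuc r - Id \<and> P B b"
proof (rule ccontr)
  let ?L = "cardSuc r"
  assume "\<not> ?thesis"
  then obtain c where c: "\<And>B. B \<in> S \<Longrightarrow> c B \<in> Field ?L"
    and no: "\<And>B b. B \<in> S \<Longrightarrow> (c B, b) \<in> ?L - Id \<Longrightarrow> \<not> P B b"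
    by metis
  have "|c ` S| \<le>o r" using ordLeq_transitive[OF card_of_image S] .
  then obtain b where b: "b \<in> Field ?L" "\<forall>x\<in>c ` S. (x, b) \<in> ?L - Id"
    using cardSuc_strict_bound[OF r, of "c ` S"] c by blast
  then show False using ex[OF b(1)] no by blast
qed

text \<open>The cardinal \<open>cf\<close> is attained by a cofinal family, which an injection
  \<open>e\<close> of \<open>G\<close> into \<open>Field \<theta>\<close> pulls back to
  \<open>G\<close>. Preimages may be smaller than \<mu>, so their size is only bounded from
  above.\<close>

lemma cf_subsets_cover:
  fixes G :: "'g set" and \<mu> :: "'m rel" and \<theta> :: "'t rel"
  assumes \<mu>: "Cinfinite \<mu>" and \<theta>: "Cinfinite \<theta>" and le: "\<mu> \<le>o \<theta>"
    and cf: "cf (subsets_of_card (Field \<theta>) \<mu>) (\<subseteq>) \<le>o \<theta>" and G: "|G| \<le>o \<theta>"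
  obtains S where "|S| \<le>o \<theta>" "\<And>B. B \<in> S \<Longrightarrow> |B| \<le>o \<mu>"
    "\<And>X. X \<subseteq> G \<Longrightarrow> |X| \<le>o \<mu> \<Longrightarrow> \<exists>B\<in>S. X \<subseteq> B"
proof -
  have \<mu>c: "Card_order \<mu>" "\<not> finite (Field \<mu>)" and \<theta>c: "Card_order \<theta>"
    using \<mu> \<theta> by (auto simp: cinfinite_def)
  obtain F where F: "cofinal_in (subsets_of_card (Field \<theta>) \<mu>) (\<subseteq>) F"
    and F_card: "|F| \<le>o \<theta>"
    using cf_attained[of "subsets_of_card (Field \<theta>) \<mu>" "(\<subseteq>)"] cf by metis
  have "|G| \<le>o |Field \<theta>|"
    using ordLeq_ordIso_trans[OF G ordIso_symmetric[OF card_of_Field_ordIso[OF \<theta>c]]] .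
  then obtain e where e: "inj_on e G" "e ` G \<subseteq> Field \<theta>"
    unfolding card_of_ordLeq[symmetric] by blast
  have "|Field \<mu>| \<le>o |Field \<theta>|"
    using le card_of_Field_ordIso[OF \<mu>c(1)] card_of_Field_ordIso[OF \<theta>c]
    by (meson ordIso_ordLeq_trans ordIso_symmetric ordLeq_ordIso_trans)
  then obtain h where h: "inj_on h (Field \<mu>)" "h ` Field \<mu> \<subseteq> Field \<theta>"
    unfolding card_of_ordLeq[symmetric] by blast
  \<comment> \<open>Cofinality speaks only of sets of size exactly \<mu>. Adding the fixed set
    \<open>?Y\<close> brings the image of a smaller \<open>X\<close> up to that size.\<close>
  let ?Y = "h ` Field \<mu>"
  have Y: "|?Y| =o \<mu>"
    using ordIso_transitive[OF ordIso_symmetric[OF card_of_ordIsoI[OF inj_on_imp_bij_betw[OF h(1)]]]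
        card_of_Field_ordIso[OF \<mu>c(1)]] .
  let ?S = "(\<lambda>B. {x \<in> G. e x \<in> B}) ` F"
  show thesis
  proof (rule that[of ?S])
    show "|?S| \<le>o \<theta>" using ordLeq_transitive[OF card_of_image F_card] .
  next
    fix B assume "B \<in> ?S"
    then obtain B' where B': "B' \<in> F" "B = {x \<in> G. e x \<in> B'}" by blast
    have "|B| \<le>o |B'|"
      unfolding card_of_ordLeq[symmetric]
      using e(1) B'(2) by (intro exI[of _ e]) (auto intro: inj_on_subset)
    moreover have "|B'| =o \<mu>"
      using F B'(1) by (auto simp: cofinal_in_def subsets_of_card_def)
    ultimately show "|B| \<le>o \<mu>" using ordLeq_ordIso_trans by blast
  next
    fix X assume X: "X \<subseteq> G" "|X| \<le>o \<mu>"
    let ?Z = "e ` X \<union> ?Y"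
    have "|?Z| \<le>o \<mu>"
      using \<mu>c ordLeq_transitive[OF card_of_image X(2)] Y
      by (intro card_of_Un_ordLeq_infinite_Field) (auto simp: ordIso_iff_ordLeq)
    moreover have "\<mu> \<le>o |?Z|"
      using ordIso_ordLeq_trans[OF ordIso_symmetric[OF Y] card_of_mono1[of ?Y ?Z]] by simp
    ultimately have "?Z \<in> subsets_of_card (Field \<theta>) \<mu>"
      using subset_trans[OF image_mono[OF X(1)] e(2)] h(2)
      by (simp add: subsets_of_card_def ordIso_iff_ordLeq)
    then obtain B where "B \<in> F" "?Z \<subseteq> B"
      using F unfolding cofinal_in_def by blast
    then show "\<exists>B\<in>?S. X \<subseteq> B" using X(1) by auto
  qed
qed

text \<open>Since \<open>Field \<kappa> \<times> M\<close> has size \<kappa>, a bijection onto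
  \<open>Field \<kappa>\<close> carries its fibres over the points of \<open>Field \<kappa>\<close>
  to the required sets.\<close>

lemma disjoint_subsets_of_card:
  fixes \<kappa> :: "'k rel" and M :: "'m set"
  assumes \<kappa>: "Cinfinite \<kappa>" and M: "M \<noteq> {}" "|M| \<le>o \<kappa>"
  obtains A where "\<And>\<xi>. \<xi> \<in> Field \<kappa> \<Longrightarrow> A \<xi> \<subseteq> Field \<kappa>"
    "\<And>\<xi>. \<xi> \<in> Field \<kappa> \<Longrightarrow> |A \<xi>| =o |M|"
    "\<And>\<xi> \<eta>. \<xi> \<in> Field \<kappa> \<Longrightarrow> \<eta> \<in> Field \<kappa> \<Longrightarrow> \<xi> \<noteq> \<eta> \<Longrightarrow> A \<xi> \<inter> A \<eta> = {}"
proof -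
  let ?K = "Field \<kappa>"
  have \<kappa>c: "Card_order \<kappa>" "\<not> finite ?K" using \<kappa> by (auto simp: cinfinite_def)
  have "|M| \<le>o |?K|"
    using ordLeq_ordIso_trans[OF M(2) ordIso_symmetric[OF card_of_Field_ordIso[OF \<kappa>c(1)]]] .
  then have "|?K \<times> M| =o |?K|" using card_of_Times_infinite[OF \<kappa>c(2) M(1)] by blast
  then obtain p where p: "bij_betw p (?K \<times> M) ?K"
    unfolding card_of_ordIso[symmetric] by blast
  let ?A = "\<lambda>\<xi>. (\<lambda>m. p (\<xi>, m)) ` M"
  show thesis
  proof (rule that[of ?A])
    fix \<xi> assume \<xi>: "\<xi> \<in> ?K"
    show "?A \<xi> \<subseteq> ?K" using p \<xi> by (auto simp: bij_betw_def)
    have "inj_on (\<lambda>m. p (\<xi>, m)) M"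
      using p \<xi> by (auto simp: bij_betw_def inj_on_def)
    then show "|?A \<xi>| =o |M|"
      using ordIso_symmetric[OF card_of_ordIsoI[OF inj_on_imp_bij_betw]] by blast
  next
    fix \<xi> \<eta> assume "\<xi> \<in> ?K" "\<eta> \<in> ?K" "\<xi> \<noteq> \<eta>"
    then show "?A \<xi> \<inter> ?A \<eta> = {}" using p by (auto simp: bij_betw_def inj_on_def)
  qed
qed

lemma no_increasing_sequence_mod_small_sets:
  fixes \<mu> :: "'m rel" and \<kappa> :: "'k rel" and \<theta> :: "'t rel" and \<gamma> :: "'g rel"
    and f :: "'t set \<Rightarrow> 'k \<Rightarrow> 'g"
  assumes \<mu>: "Cinfinite \<mu>" and \<kappa>: "Cinfinite \<kappa>" and \<theta>: "Cinfinite \<theta>"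
    and \<mu>\<kappa>: "cardSuc \<mu> <o \<kappa>" and \<kappa>\<theta>: "\<kappa> \<le>o \<theta>"
    and cf: "cf (subsets_of_card (Field \<theta>) \<mu>) (\<subseteq>) \<le>o \<theta>"
    and \<gamma>: "Well_order \<gamma>" and \<gamma>\<theta>: "\<gamma> <o cardSuc \<theta>"
    and f: "\<And>\<alpha>. \<alpha> \<in> Field (cardSuc \<theta>) \<Longrightarrow> f \<alpha> \<in> Func (Field \<kappa>) (Field \<gamma>)"
    and incr: "\<And>\<alpha> \<beta>. (\<alpha>, \<beta>) \<in> cardSuc \<theta> - Id \<Longrightarrow>
      less_mod (Field \<kappa>) \<gamma> (subsets_less_card (Field \<kappa>) \<mu>) (f \<alpha>) (f \<beta>)"
  shows False
proof -
  let ?K = "Field \<kappa>" and ?L = "cardSuc \<theta>" and ?M = "cardSuc \<mu>"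
  let ?bad = "\<lambda>\<alpha> \<beta>. {i \<in> ?K. (f \<beta> i, f \<alpha> i) \<in> \<gamma>}"
  have \<mu>c: "Card_order \<mu>" "\<not> finite (Field \<mu>)"
    and \<kappa>c: "Card_order \<kappa>" "\<not> finite ?K"
    and \<theta>c: "Card_order \<theta>" "\<not> finite (Field \<theta>)"
    using \<mu> \<kappa> \<theta> by (auto simp: cinfinite_def)
  have M: "Card_order ?M" "Well_order ?M" "\<not> finite (Field ?M)"
    using cardSuc_Card_order[OF \<mu>c(1)] cardSuc_finite[OF \<mu>c(1)] \<mu>c(2)
    by (auto simp: card_order_on_def)
  have \<mu>M: "\<mu> <o ?M" using cardSuc_greater[OF \<mu>c(1)] .
  have \<mu>_\<kappa>: "\<mu> \<le>o \<kappa>" using ordLess_imp_ordLeq[OF ordLess_transitive[OF \<mu>M \<mu>\<kappa>]] .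
  have \<mu>_\<theta>: "\<mu> \<le>o \<theta>" using ordLeq_transitive[OF \<mu>_\<kappa> \<kappa>\<theta>] .
  have K_\<theta>: "|?K| \<le>o \<theta>" using ordIso_ordLeq_trans[OF card_of_Field_ordIso[OF \<kappa>c(1)] \<kappa>\<theta>] .
  have "|Field \<gamma>| <o ?L" using ordLeq_ordLess_trans[OF card_of_least[OF \<gamma>] \<gamma>\<theta>] .
  then have G: "|Field \<gamma>| \<le>o \<theta>"
    using cardSuc_ordLeq_ordLess[OF \<theta>c(1) card_of_Card_order] by blast
  obtain A where A: "\<And>\<xi>. \<xi> \<in> ?K \<Longrightarrow> A \<xi> \<subseteq> ?K"
    "\<And>\<xi>. \<xi> \<in> ?K \<Longrightarrow> |A \<xi>| =o |Field \<mu>|"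
    "\<And>\<xi> \<eta>. \<xi> \<in> ?K \<Longrightarrow> \<eta> \<in> ?K \<Longrightarrow> \<xi> \<noteq> \<eta> \<Longrightarrow> A \<xi> \<inter> A \<eta> = {}"
    using disjoint_subsets_of_card[OF \<kappa>, of "Field \<mu>"] \<mu>c
      ordIso_ordLeq_trans[OF card_of_Field_ordIso[OF \<mu>c(1)] \<mu>_\<kappa>] by (metis finite.emptyI)
  have A_card: "|A \<xi>| =o \<mu>" if "\<xi> \<in> ?K" for \<xi>
    using ordIso_transitive[OF A(2)[OF that] card_of_Field_ordIso[OF \<mu>c(1)]] .
  obtain S where S: "|S| \<le>o \<theta>" "\<And>B. B \<in> S \<Longrightarrow> |B| \<le>o \<mu>"
    "\<And>X. X \<subseteq> Field \<gamma> \<Longrightarrow> |X| \<le>o \<mu> \<Longrightarrow> \<exists>B\<in>S. X \<subseteq> B"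
    using cf_subsets_cover[OF \<mu> \<theta> \<mu>_\<theta> cf G] by blast
  have "\<exists>B\<in>S. \<forall>a\<in>Field ?L. \<exists>b. (a, b) \<in> ?L - Id \<and> f b ` A \<xi> \<subseteq> B" if \<xi>: "\<xi> \<in> ?K" for \<xi>
  proof (rule cardSuc_pigeonhole[OF \<theta> S(1)])
    fix a assume "a \<in> Field ?L"
    then have "f a ` A \<xi> \<subseteq> Field \<gamma>" using f A(1)[OF \<xi>] by (auto simp: Func_def)
    moreover have "|f a ` A \<xi>| \<le>o \<mu>" using ordLeq_ordIso_trans[OF card_of_image A_card[OF \<xi>]] .
    ultimately show "\<exists>B\<in>S. f a ` A \<xi> \<subseteq> B" using S(3) by blast
  qed
  then obtain B where B: "\<And>\<xi>. \<xi> \<in> ?K \<Longrightarrow> B \<xi> \<in> S"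
    and "\<And>\<xi>. \<xi> \<in> ?K \<Longrightarrow> \<forall>a\<in>Field ?L. \<exists>b. (a, b) \<in> ?L - Id \<and> f b ` A \<xi> \<subseteq> B \<xi>"
    by metis
  then obtain nxt where nxt: "\<And>\<xi> a. \<xi> \<in> ?K \<Longrightarrow> a \<in> Field ?L \<Longrightarrow> (a, nxt \<xi> a) \<in> ?L - Id"
    "\<And>\<xi> a. \<xi> \<in> ?K \<Longrightarrow> a \<in> Field ?L \<Longrightarrow> f (nxt \<xi> a) ` A \<xi> \<subseteq> B \<xi>"
    by metis
  \<comment> \<open>The bound must serve all \<xi> at once, because the final \<xi> is chosen only
    after the sequence \<alpha> is built. It exists since there are at most \<theta> many points
    \<open>nxt \<xi> a\<close>. The resulting \<open>g (\<alpha> j)\<close> is the second member of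
    the pair with index \<open>j\<close>.\<close>
  have "\<forall>a\<in>Field ?L. \<exists>b. b \<in> Field ?L \<and> (\<forall>\<xi>\<in>?K. (nxt \<xi> a, b) \<in> ?L - Id)"
  proof
    fix a assume a: "a \<in> Field ?L"
    have small: "|(\<lambda>\<xi>. nxt \<xi> a) ` ?K| \<le>o \<theta>" using ordLeq_transitive[OF card_of_image K_\<theta>] .
    have rng: "(\<lambda>\<xi>. nxt \<xi> a) ` ?K \<subseteq> Field ?L"
      using nxt(1)[OF _ a] by (auto simp: Field_def)
    show "\<exists>b. b \<in> Field ?L \<and> (\<forall>\<xi>\<in>?K. (nxt \<xi> a, b) \<in> ?L - Id)"
      using cardSuc_strict_bound[OF \<theta> rng small] by (simp add: Bex_def)
  qed
  from bchoice[OF this] obtain g where g: "\<And>a. a \<in> Field ?L \<Longrightarrow> g a \<in> Field ?L"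
    "\<And>a \<xi>. a \<in> Field ?L \<Longrightarrow> \<xi> \<in> ?K \<Longrightarrow> (nxt \<xi> a, g a) \<in> ?L - Id"
    by blast
  \<comment> \<open>Recursion along \<open>?M\<close>: before stage \<open>k\<close> there are at
    most \<mu> many values \<open>g (\<alpha> j)\<close>, so they have a strict bound in
    \<open>?L\<close>. The index ranges over the whole type; outside \<open>Field ?M\<close> it has
    no predecessors.\<close>
  have "\<exists>\<alpha>. \<forall>k. \<alpha> k \<in> Field ?L \<and> (\<forall>j\<in>underS ?M k. (g (\<alpha> j), \<alpha> k) \<in> ?L - Id)"
  proof (rule dependent_wf_choice[where R = "?M - Id"])
    show "wf (?M - Id)" using M(2) by (simp add: well_order_on_def)
  next
    fix \<alpha> \<alpha>' :: "'m set \<Rightarrow> 't set" and k r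
    assume "\<And>j. (j, k) \<in> ?M - Id \<Longrightarrow> \<alpha> j = \<alpha>' j"
    then show "(r \<in> Field ?L \<and> (\<forall>j\<in>underS ?M k. (g (\<alpha> j), r) \<in> ?L - Id)) =
        (r \<in> Field ?L \<and> (\<forall>j\<in>underS ?M k. (g (\<alpha>' j), r) \<in> ?L - Id))"
      by (auto simp: underS_def)
  next
    fix k and \<alpha> :: "'m set \<Rightarrow> 't set"
    assume IH: "\<And>j. (j, k) \<in> ?M - Id \<Longrightarrow>
      \<alpha> j \<in> Field ?L \<and> (\<forall>l\<in>underS ?M j. (g (\<alpha> l), \<alpha> j) \<in> ?L - Id)"
    let ?X = "(\<lambda>j. g (\<alpha> j)) ` underS ?M k"
    have "|underS ?M k| <o ?M"
    proof (cases "k \<in> Field ?M")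
      case True
      then show ?thesis using card_of_underS[OF M(1)] by blast
    next
      case False
      then have "underS ?M k = {}" by (auto simp: underS_def Field_def)
      moreover have "|{} :: 'm set set| <o ?M"
        by (rule finite_ordLess_infinite[OF card_of_Well_order M(2) _ M(3)]) (simp add: Field_card_of)
      ultimately show ?thesis by simp
    qed
    then have "|underS ?M k| \<le>o \<mu>"
      using cardSuc_ordLeq_ordLess[OF \<mu>c(1) card_of_Card_order] by blast
    then have small: "|?X| \<le>o \<theta>"
      using ordLeq_transitive[OF card_of_image ordLeq_transitive[OF _ \<mu>_\<theta>]] by blast
    have rng: "?X \<subseteq> Field ?L" using IH g(1) by (auto simp: underS_def)
    show "\<exists>r. r \<in> Field ?L \<and> (\<forall>j\<in>underS ?M k. (g (\<alpha> j), r) \<in> ?L - Id)"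
      using cardSuc_strict_bound[OF \<theta> rng small] by (simp add: Bex_def)
  qed
  then obtain \<alpha> where
    rec: "\<forall>k. \<alpha> k \<in> Field ?L \<and> (\<forall>j\<in>underS ?M k. (g (\<alpha> j), \<alpha> k) \<in> ?L - Id)" ..
  have \<alpha>: "\<alpha> k \<in> Field ?L" "(j, k) \<in> ?M - Id \<Longrightarrow> (g (\<alpha> j), \<alpha> k) \<in> ?L - Id" for j k
    using rec by (auto simp: underS_def)
  have small: "|?bad a b| <o \<mu>" if "(a, b) \<in> ?L - Id" for a b
    using incr[OF that] by (simp add: less_mod_def subsets_less_card_def)

  define E where "E = (\<Union>(j, k)\<in>?M - Id. ?bad (g (\<alpha> j)) (\<alpha> k))"
  have E_card: "|E| \<le>o ?M"
    unfolding E_def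
  proof (rule card_of_UNION_ordLeq_infinite_Field[OF M(3,1)])
    have "|Field ?M| \<le>o ?M" using card_of_Field_ordIso[OF M(1)] by (simp add: ordIso_iff_ordLeq)
    then have "|Field ?M \<times> Field ?M| \<le>o ?M"
      using card_of_Times_ordLeq_infinite_Field M(1,3) by blast
    moreover have "?M - Id \<subseteq> Field ?M \<times> Field ?M" by (auto simp: Field_def)
    ultimately show "|?M - Id| \<le>o ?M" using card_of_mono1 ordLeq_transitive by blast
    show "\<forall>p\<in>?M - Id. |case p of (j, k) \<Rightarrow> ?bad (g (\<alpha> j)) (\<alpha> k)| \<le>o ?M"
      using ordLess_imp_ordLeq[OF ordLess_transitive[OF small[OF \<alpha>(2)] \<mu>M]] by auto
  qed
  have "\<exists>\<xi>\<in>?K. A \<xi> \<inter> E = {}"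
  proof (rule ccontr)
    assume "\<not> ?thesis"
    then have "\<forall>\<xi>\<in>?K. \<exists>x. x \<in> A \<xi> \<inter> E" by blast
    \<comment> \<open>As the sets \<open>A \<xi>\<close> are disjoint, choosing a point of
      \<open>E\<close> in each of them would inject \<kappa> into \<open>E\<close>, which has size
      at most \<open>?M\<close>.\<close>
    from bchoice[OF this] obtain e where e: "\<And>\<xi>. \<xi> \<in> ?K \<Longrightarrow> e \<xi> \<in> A \<xi> \<inter> E" by blast
    then have "inj_on e ?K" using A(3) by (fastforce simp: inj_on_def)
    then have "|?K| \<le>o |E|" unfolding card_of_ordLeq[symmetric] using e by blast
    then have "\<kappa> \<le>o ?M"
      using ordIso_ordLeq_trans[OF ordIso_symmetric[OF card_of_Field_ordIso[OF \<kappa>c(1)]]]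
        ordLeq_transitive[OF _ E_card] by blast
    then show False using \<mu>\<kappa> not_ordLess_ordLeq by blast
  qed
  then obtain \<xi> where \<xi>: "\<xi> \<in> ?K" "A \<xi> \<inter> E = {}" by blast

  let ?b = "\<lambda>j. nxt \<xi> (\<alpha> j)"
  \<comment> \<open>Two sets of size less than the infinite cardinal \<mu> cannot cover
    \<open>A \<xi>\<close>, which has size exactly \<mu>.\<close>
  have "\<forall>j. \<exists>i. i \<in> A \<xi> - (?bad (\<alpha> j) (?b j) \<union> ?bad (?b j) (g (\<alpha> j)))"
  proof (rule allI, rule ccontr)
    fix j
    let ?D = "?bad (\<alpha> j) (?b j) \<union> ?bad (?b j) (g (\<alpha> j))"
    assume "\<nexists>i. i \<in> A \<xi> - ?D"
    then have "A \<xi> \<subseteq> ?D" by blast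
    then have "|A \<xi>| \<le>o |?D|" by (rule card_of_mono1)
    moreover have "|?D| <o \<mu>"
      using card_of_Un_ordLess_infinite_Field[OF \<mu>c(2,1) small[OF nxt(1)[OF \<xi>(1) \<alpha>(1)]]
          small[OF g(2)[OF \<alpha>(1) \<xi>(1)]]] .
    ultimately show False
      using A_card[OF \<xi>(1)] ordLeq_ordLess_trans not_ordLess_ordIso by blast
  qed
  from choice[OF this] obtain i where
    i_mem: "\<forall>j. i j \<in> A \<xi> - (?bad (\<alpha> j) (?b j) \<union> ?bad (?b j) (g (\<alpha> j)))" ..
  have i: "i j \<in> A \<xi>" "i j \<notin> ?bad (\<alpha> j) (?b j)" "i j \<notin> ?bad (?b j) (g (\<alpha> j))" for j
    using i_mem by blast+
  have lin: "Linear_order \<gamma>" using \<gamma> by (simp add: well_order_on_def)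
  have lt: "(f a l, f b l) \<in> \<gamma> - Id"
    if "l \<in> ?K" "l \<notin> ?bad a b" "a \<in> Field ?L" "b \<in> Field ?L" for a b l
  proof -
    have "f a l \<in> Field \<gamma>" "f b l \<in> Field \<gamma>" using f that by (auto simp: Func_def)
    then show ?thesis using that(1,2) lin
      by (cases "f a l = f b l") (auto simp: order_on_defs refl_on_def total_on_def)
  qed
  have tr: "(x, z) \<in> \<gamma> - Id" if "(x, y) \<in> \<gamma> - Id" "(y, z) \<in> \<gamma> - Id" for x y z
    using Linear_order_le_less_trans[OF lin _ that(2)] that(1) by blast
  have b_Field: "?b j \<in> Field ?L" for j using nxt(1)[OF \<xi>(1) \<alpha>(1)] by (auto simp: Field_def)
  let ?p = "\<lambda>j. (i j, f (?b j) (i j))"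
  have ne: "?p j \<noteq> ?p k" if jk: "(j, k) \<in> ?M - Id" for j k
  proof
    assume eq: "?p j = ?p k"
    have K: "i j \<in> ?K" using i(1) A(1)[OF \<xi>(1)] by blast
    have "i j \<notin> ?bad (g (\<alpha> j)) (\<alpha> k)" using i(1) \<xi>(2) jk unfolding E_def by blast
    \<comment> \<open>At the common coordinate \<open>i j = i k\<close> the values of
      \<open>f\<close> strictly increase along \<open>?b j\<close>, \<open>g (\<alpha> j)\<close>,
      \<open>\<alpha> k\<close>, \<open>?b k\<close>. The middle step holds because
      \<open>A \<xi>\<close> avoids \<open>E\<close>; the outer two come from the choice of
      \<open>i j\<close> and \<open>i k\<close>.\<close>
    then have "(f (?b j) (i j), f (?b k) (i j)) \<in> \<gamma> - Id"
      using tr[OF lt[OF K i(3) b_Field g(1)[OF \<alpha>(1)]]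
          tr[OF lt[OF K _ g(1)[OF \<alpha>(1)] \<alpha>(1)] lt[OF K _ \<alpha>(1) b_Field]]]
        i(2)[of k] eq by auto
    then show False using eq by auto
  qed
  have "inj_on ?p (Field ?M)"
  proof (rule inj_onI, rule ccontr)
    fix j k assume jk: "j \<in> Field ?M" "k \<in> Field ?M" "?p j = ?p k" "j \<noteq> k"
    have "Total ?M" using M(2) by (simp add: order_on_defs)
    then have "(j, k) \<in> ?M - Id \<or> (k, j) \<in> ?M - Id"
      using jk(1,2,4) unfolding total_on_def by blast
    then show False using ne jk(3) by metis
  qed
  moreover have "?p ` Field ?M \<subseteq> A \<xi> \<times> B \<xi>"
    using i(1) nxt(2)[OF \<xi>(1) \<alpha>(1)] by blast
  ultimately have "|Field ?M| \<le>o |A \<xi> \<times> B \<xi>|" unfolding card_of_ordLeq[symmetric] by blast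
  moreover have "|A \<xi> \<times> B \<xi>| \<le>o \<mu>"
    using card_of_Times_ordLeq_infinite_Field[OF \<mu>c(2)
        ordIso_imp_ordLeq[OF A_card[OF \<xi>(1)]] S(2)[OF B[OF \<xi>(1)]] \<mu>c(1)] .
  ultimately have "?M \<le>o \<mu>"
    using ordIso_ordLeq_trans[OF ordIso_symmetric[OF card_of_Field_ordIso[OF M(1)]]]
      ordLeq_transitive by blast
  then show False using \<mu>M not_ordLess_ordLeq by blast
qed

theorem theorem4:
  fixes \<mu> :: "'m rel" and \<kappa> :: "'k rel" and \<theta> :: "'t rel" and \<gamma> :: "'g rel"
    and J :: "'k set set"
  assumes "Cinfinite \<mu>" and "Cinfinite \<kappa>" and "Cinfinite \<theta>"
    and "cardSuc \<mu> <o \<kappa>" and "\<kappa> \<le>o \<theta>"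
    and "cf (subsets_of_card (Field \<theta>) \<mu>) (\<subseteq>) \<le>o \<theta>"
    and "J = subsets_less_card (Field \<kappa>) \<mu>"
    and "Well_order \<gamma>" and "\<gamma> <o cardSuc \<theta>"
  shows "Depth (Func (Field \<kappa>) (Field \<gamma>)) (less_mod (Field \<kappa>) \<gamma> J) \<le>o \<theta>
    \<and> \<not> (\<exists>f :: 't set \<Rightarrow> 'k \<Rightarrow> 'g.
          (\<forall>\<alpha> \<in> Field (cardSuc \<theta>). f \<alpha> \<in> Func (Field \<kappa>) (Field \<gamma>))
        \<and> (\<forall>\<alpha> \<beta>. (\<alpha>, \<beta>) \<in> cardSuc \<theta> \<and> \<alpha> \<noteq> \<beta>
              \<longrightarrow> less_mod (Field \<kappa>) \<gamma> J (f \<alpha>) (f \<beta>)))"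
proof
  let ?P = "Func (Field \<kappa>) (Field \<gamma>)" and ?lt = "less_mod (Field \<kappa>) \<gamma> J"
  let ?L = "cardSuc \<theta>"
  show no_seq: "\<not> (\<exists>f :: 't set \<Rightarrow> 'k \<Rightarrow> 'g. (\<forall>\<alpha> \<in> Field ?L. f \<alpha> \<in> ?P)
      \<and> (\<forall>\<alpha> \<beta>. (\<alpha>, \<beta>) \<in> ?L \<and> \<alpha> \<noteq> \<beta> \<longrightarrow> ?lt (f \<alpha>) (f \<beta>)))"
    using no_increasing_sequence_mod_small_sets[OF assms(1-6,8,9)] assms(7) by blast
  have \<theta>: "Card_order \<theta>" using assms(3) by blast
  show "Depth ?P ?lt \<le>o \<theta>"
  proof (rule Depth_least[OF \<theta>], rule ccontr)
    fix F assume F: "well_ordered_subset ?P ?lt F" and "\<not> |F| \<le>o \<theta>"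
    let ?r = "{(x, y). x \<in> F \<and> y \<in> F \<and> ?lt\<^sup>=\<^sup>= x y}"
    have F_P: "F \<subseteq> ?P" and r: "well_order_on F ?r"
      using F by (auto simp: well_ordered_subset_def)
    have F_Field: "Field ?r = F" using well_order_on_Field[OF r] by simp
    have "\<theta> <o |F|"
      using \<open>\<not> |F| \<le>o \<theta>\<close>
        not_ordLeq_iff_ordLess[OF card_order_on_well_order_on[OF \<theta>] card_of_Well_order]
      by blast
    \<comment> \<open>The cardinal of \<open>F\<close> is least among the well-orders on
      \<open>F\<close>, so \<open>?L\<close> embeds into \<open>?r\<close>. Injectivity of the
      embedding removes the equality case of the reflexive closure and gives the forbidden
      sequence.\<close>
    then have "?L \<le>o |F|" using cardSuc_ordLess_ordLeq[OF \<theta> card_of_Card_order] by blast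
    then have "?L \<le>o ?r" using ordLeq_transitive card_of_least[OF r] by blast
    then obtain h where L: "Well_order ?L" and h: "embed ?L ?r h"
      unfolding ordLeq_def by blast
    have inj: "inj_on h (Field ?L)" using embed_inj_on[OF L h] .
    have rng: "h \<alpha> \<in> ?P" if "\<alpha> \<in> Field ?L" for \<alpha>
      using embed_Field[OF h] F_Field F_P that by blast
    have "?lt (h \<alpha>) (h \<beta>)" if "(\<alpha>, \<beta>) \<in> ?L" "\<alpha> \<noteq> \<beta>" for \<alpha> \<beta>
    proof -
      have "(h \<alpha>, h \<beta>) \<in> ?r" using embed_compat[OF h] that(1) unfolding compat_def by (elim allE impE)
      moreover have "h \<alpha> \<noteq> h \<beta>" using inj that by (auto simp: inj_on_def Field_def)
      ultimately show ?thesis by auto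
    qed
    with no_seq rng show False by blast
  qed
qed

end
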